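(* Assume the smoothness, Lyapunov, second-order-growth, regularity, contraction and state-evolution assumptions stated in the context. Then there exists $T^*>0$ such that for every sampling time $T\in(0,T^*]$ the origin $\xi=(x,z-\bar z(x))=(0,0)$ is locally asymptotically stable for the system-optimizer dynamics $\xi_+=\Phi(T;\xi)$, i.e. for the dynamics $$x_+=\psi(T;x,M_{u,z}z),\qquad z_+=\varphi(\psi(T;x,M_{u,z}z),z)$$ written in the coordinates $\xi=(x,z-\bar z(x))$.
   Context: Notation. $\|\cdot\|$ is the Euclidean norm for vectors and the spectral norm for matrices; $\mathcal{B}(x,r)=\{y:\|x-y\|\le r\}$; $\nabla f$ is the transposed Jacobian. Problem. For a parameter $x\in\mathbb{R}^{n_x}$, $P(x)$ is the problem $\min_{y\in\mathbb{R}^n} f(y)$ s.t. $g(y)+Bx=0$, with $f:\mathbb{R}^n\to\mathbb{R}$, $g:\mathbb{R}^n\to\mathbb{R}^{n_g}$, $B\in\mathbb{R}^{n_g\times n_x}$ constant. $X$ is the set of $x$ for which $P(x)$ has a solution; $\bar y(x)$ solves $P(x)$; $V(x)=f(\bar y(x))$; $\bar V>0$ is fixed and $X_{\bar V}=\{x: V(x)\le\bar V\}$. An inequality involving $V$ at a point includes the assertion that the point lies in $X$. With $z=(y,\lambda)\in\mathbb{R}^{n_z}$, $n_z=n+n_g$, the first-order optimality conditions are $F(z)+Cx=0$, where $F(z)=(\nabla f(y)+\nabla g(y)\lambda,\ g(y))$ and $C=[0\ \ B^\top]^\top$; $\bar Z(x)$ is the set of $z$ satisfying them. The feedback policy is $\bar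 u(x)=M_{u,y}\bar y(x)$ with a constant projection (selection) matrix $M_{u,y}$, $\|M_{u,y}\|=1$; $M_{u,z}$ is the corresponding projection with $M_{u,z}z=M_{u,y}y$, $\|M_{u,z}\|=1$. System. $\psi(t;x_0,u_0)$ is the solution of $\frac{d}{dt}\psi=\phi(\psi,u_0)$, $\psi(0;x_0,u_0)=x_0$, for constant input $u_0\in\mathbb{R}^{n_u}$, where $\phi:\mathbb{R}^{n_x}\times\mathbb{R}^{n_u}\to\mathbb{R}^{n_x}$, $\phi(0,0)=0$. The number $T>0$ is the sampling time. Optimizer. One iteration of the optimizer for parameter value $x$ maps $z$ to $\varphi(x,z)$, $\varphi:\mathbb{R}^{n_x}\times\mathbb{R}^{n_z}\to\mathbb{R}^{n_z}$. Error dynamics. The map $\Phi(T;\cdot)$ sends $(x,z-\bar z(x))$ to $(x_+,z_+-\bar z(x_+))$; it is considered for $x\in X_{\bar V}$, where $\bar z(x)$ is defined (so local asymptotic stability concerns initial states $\xi_0$ close to $0$ with $x_0\in X_{\bar V}$). Assumptions. Smoothness: $f,g$ are twice continuously differentiable with bounded first and second order derivatives. Lyapunov: there are positive constants $a_1,a_2,a_3,T_0$ such that for all $x\in X_{\bar V}$ and $0<T\le T_0$: $a_1\|x\|^2\le V(x)\le a_2\|x\|^2$ and $V(\psi(T;x,\bar u(x)))-V(x)\le -T a_3\|x\|^2$. Second-order growth: for all $u\in\mathbb{R}^{n_u}$, $x\in X_{\bar V}$, $0<T\le T_0$: $V(\psi(T;x,u))-V(x)\le -Ta_3\|x\|^2+T\,O(\|u-\bar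 u(x)\|^2)$, where the $O$-term is bounded by a constant times $\|u-\bar u(x)\|^2$ for $\|u-\bar u(x)\|$ small, uniformly in $x\in X_{\bar V}$ and $T\in(0,T_0]$. Regularity: for every $x\in X_{\bar V}$ there is a unique solution $\bar z(x)$ of $F(z)+Cx=0$ (with primal part $\bar y(x)$), second order sufficient conditions hold at $\bar z(x)$, and $\bar Z(0)=\{0\}$, i.e. $\bar z(0)=0$. Contraction: there are $\hat r_z>0$ and $0<\hat\kappa<1$ such that for all $x\in X_{\bar V}$ and $z\in\mathcal{B}(\bar z(x),\hat r_z)$, $\|\varphi(x,z)-\bar z(x)\|\le\hat\kappa\|z-\bar z(x)\|$. State evolution: there are positive finite constants $L_{\psi,x},L_{\psi,u}$ such that for all $x\in X_{\bar V}$, all $z$ with $\|z-\bar z(x)\|\le r_z$ and all $0<T\le T_0$, $\|\psi(T;x,M_{u,z}z)-x\|\le T(L_{\psi,x}\|x\|+L_{\psi,u}\|M_{u,z}z\|)$. Constants. $r_z,r_x,\sigma>0$ are such that for all $x\in X_{\bar V}$, $z\in\mathcal{B}(\bar z(x),r_z)$, $x_+\in\mathcal{B}(x,r_x)$, with $z_+=\varphi(x_+,z)$: $\|z_+-\bar z(x_+)\|\le\hat\kappa\|z-\bar z(x)\|+\sigma\hat\kappa\|x_+-x\|$, and $\sigma$ is a Lipschitz constant of $x\mapsto\bar z(x)$ on $X_{\bar V}$. *)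

theory Defs
  imports "HOL-Analysis.Analysis"
begin

definition gradient :: "(real ^ 'n \<Rightarrow> real) \<Rightarrow> real ^ 'n \<Rightarrow> real ^ 'n" where
  "gradient h y = (\<chi> i. frechet_derivative h (at y) (axis i 1))"

definition hessian :: "(real ^ 'n \<Rightarrow> real) \<Rightarrow> real ^ 'n \<Rightarrow> real ^ 'n ^ 'n" where
  "hessian h y = jacobian (gradient h) (at y)"

text \<open>Derivatives are bounded in the operator norm.\<close>

definition C2_bounded :: "('a::real_normed_vector \<Rightarrow> 'b::real_normed_vector) \<Rightarrow> bool" where
  "C2_bounded h \<longleftrightarrow>
     (\<exists>(h' :: 'a \<Rightarrow> 'a \<Rightarrow>\<^sub>L 'b) (h'' :: 'a \<Rightarrow> 'a \<Rightarrow>\<^sub>L 'a \<Rightarrow>\<^sub>L 'b).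
        (\<forall>y. (h has_derivative blinfun_apply (h' y)) (at y)) \<and>
        (\<forall>y. (h' has_derivative blinfun_apply (h'' y)) (at y)) \<and>
        continuous_on UNIV h'' \<and> bounded (range h') \<and> bounded (range h''))"

definition solves_P ::
  "(real ^ 'n \<Rightarrow> real) \<Rightarrow> (real ^ 'n \<Rightarrow> real ^ 'g) \<Rightarrow> real ^ 'x ^ 'g \<Rightarrow> real ^ 'x \<Rightarrow> real ^ 'n \<Rightarrow> bool" where
  "solves_P f g B x y \<longleftrightarrow>
     g y + B *v x = 0 \<and> (\<forall>y'. g y' + B *v x = 0 \<longrightarrow> f y \<le> f y')"

text \<open>
  A primal-dual point is a pair \<open>z = (y, \<lambda>)\<close>; the norm of the product type is the Euclidean norm
  of the stacked vector. The symbol \<open>\<nabla>g\<close> is the transposed Jacobian, and the block matrix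
  \<open>C\<close>, with zero upper block and lower block \<open>B\<close>, acts by \<open>x \<mapsto> (0, B x)\<close>.
\<close>

definition FOC_map ::
  "(real ^ 'n \<Rightarrow> real) \<Rightarrow> (real ^ 'n \<Rightarrow> real ^ 'g) \<Rightarrow> (real ^ 'n) \<times> (real ^ 'g) \<Rightarrow> (real ^ 'n) \<times> (real ^ 'g)" where
  "FOC_map f g z =
     (gradient f (fst z) + transpose (jacobian g (at (fst z))) *v snd z, g (fst z))"

definition C_map :: "real ^ 'x ^ 'g \<Rightarrow> real ^ 'x \<Rightarrow> (real ^ 'n) \<times> (real ^ 'g)" where
  "C_map B x = (0, B *v x)"

definition FOC_points ::
  "(real ^ 'n \<Rightarrow> real) \<Rightarrow> (real ^ 'n \<Rightarrow> real ^ 'g) \<Rightarrow> real ^ 'x ^ 'g \<Rightarrow> real ^ 'x \<Rightarrow> ((real ^ 'n) \<times> (real ^ 'g)) set" where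
  "FOC_points f g B x = {z. FOC_map f g z + C_map B x = 0}"

definition SOSC ::
  "(real ^ 'n \<Rightarrow> real) \<Rightarrow> (real ^ 'n \<Rightarrow> real ^ 'g) \<Rightarrow> real ^ 'x ^ 'g \<Rightarrow> real ^ 'x \<Rightarrow> (real ^ 'n) \<times> (real ^ 'g) \<Rightarrow> bool" where
  "SOSC f g B x z \<longleftrightarrow>
     z \<in> FOC_points f g B x \<and>
     (\<forall>d. d \<noteq> 0 \<and> jacobian g (at (fst z)) *v d = 0 \<longrightarrow>
        d \<bullet> (hessian (\<lambda>y. f y + snd z \<bullet> g y) (fst z) *v d) > 0)"

definition selection_matrix :: "real ^ 'n ^ 'u \<Rightarrow> bool" where
  "selection_matrix M \<longleftrightarrow> (\<exists>s. inj s \<and> (\<forall>i. row i M = axis (s i) 1))"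

definition ode_solution ::
  "('x::real_normed_vector \<Rightarrow> 'u \<Rightarrow> 'x) \<Rightarrow> 'u \<Rightarrow> 'x \<Rightarrow> real \<Rightarrow> (real \<Rightarrow> 'x) \<Rightarrow> bool" where
  "ode_solution \<phi> u0 x0 \<tau> s \<longleftrightarrow>
     s 0 = x0 \<and> (\<forall>t\<in>{0..\<tau>}. (s has_vector_derivative \<phi> (s t) u0) (at t within {0..\<tau>}))"

definition M_uz :: "real ^ 'n ^ 'u \<Rightarrow> (real ^ 'n) \<times> (real ^ 'g) \<Rightarrow> real ^ 'u" where
  "M_uz M z = M *v fst z"

text \<open>
  One step of the closed loop at sampling time \<open>T\<close>, in the error coordinates
  \<open>\<xi> = (x, z - zbar x)\<close>.
\<close>

definition error_map ::
  "(real \<Rightarrow> real ^ 'x \<Rightarrow> real ^ 'u \<Rightarrow> real ^ 'x) \<Rightarrow>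
   (real ^ 'x \<Rightarrow> (real ^ 'n) \<times> (real ^ 'g) \<Rightarrow> (real ^ 'n) \<times> (real ^ 'g)) \<Rightarrow>
   real ^ 'n ^ 'u \<Rightarrow> (real ^ 'x \<Rightarrow> (real ^ 'n) \<times> (real ^ 'g)) \<Rightarrow> real \<Rightarrow>
   (real ^ 'x) \<times> (real ^ 'n) \<times> (real ^ 'g) \<Rightarrow> (real ^ 'x) \<times> (real ^ 'n) \<times> (real ^ 'g)" where
  "error_map \<psi> opt M zbar T \<xi> =
     (let x = fst \<xi>; z = snd \<xi> + zbar x;
          x_next = \<psi> T x (M_uz M z); z_next = opt x_next z
      in (x_next, z_next - zbar x_next))"

text \<open>
  Local asymptotic stability of \<open>p\<close> for a map that is meaningful only on \<open>D\<close>: trajectories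
  starting in \<open>D\<close> near \<open>p\<close> never leave \<open>D\<close>. If \<open>p \<in> D\<close>, stability forces \<open>\<Phi> p = p\<close>.
\<close>

definition locally_asymptotically_stable_on :: "'a::metric_space set \<Rightarrow> ('a \<Rightarrow> 'a) \<Rightarrow> 'a \<Rightarrow> bool" where
  "locally_asymptotically_stable_on D \<Phi> p \<longleftrightarrow>
     (\<forall>\<epsilon>>0. \<exists>\<delta>>0. \<forall>\<xi>0\<in>D. dist \<xi>0 p < \<delta> \<longrightarrow>
        (\<forall>k. (\<Phi> ^^ k) \<xi>0 \<in> D \<and> dist ((\<Phi> ^^ k) \<xi>0) p < \<epsilon>)) \<and>
     (\<exists>\<eta>>0. \<forall>\<xi>0\<in>D. dist \<xi>0 p < \<eta> \<longrightarrow> (\<lambda>k. (\<Phi> ^^ k) \<xi>0) \<longlonglongrightarrow> p)"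

end

theory Submission
  imports Defs
begin

text \<open>
  Write \<open>e = z - zbar x\<close>. The interconnection is stable because plant and optimizer have separated
  time scales: over one step the state moves only by \<open>O(T)\<close>, whereas the optimizer contracts its
  error by the factor \<open>\<kappa>\<close> whatever \<open>T\<close> is. A single quadratic Lyapunov function,
  \<open>W(x, e) = V x + \<parallel>e\<parallel>\<^sup>2\<close>, exhibits this. Since \<open>M\<close> has norm one, the input error is at most
  \<open>\<parallel>e\<parallel>\<close>, so the growth condition gives
  \<open>V x_next \<le> V x - T a3 \<parallel>x\<parallel>\<^sup>2 + T c \<parallel>e\<parallel>\<^sup>2\<close>. The state increment is at most
  \<open>T (K \<parallel>x\<parallel> + L_u \<parallel>e\<parallel>)\<close> with \<open>K = L_x + L_u \<sigma>\<close>; inserting it in the perturbed contraction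
  estimate and using convexity of the square gives
  \<open>\<parallel>e_next\<parallel>\<^sup>2 \<le> \<mu> \<parallel>e\<parallel>\<^sup>2 + T\<^sup>2 d \<parallel>x\<parallel>\<^sup>2\<close> with a fixed \<open>\<mu> < 1\<close>. In the sum both cross terms
  are dominated for small \<open>T\<close>: \<open>T\<^sup>2 d\<close> by \<open>T a3\<close>, and \<open>T c\<close> by \<open>1 - \<mu>\<close>. Hence \<open>W\<close> decays by a
  constant factor per step (\<open>composite_energy_decay\<close>) on a sublevel set so small that every local
  hypothesis applies there. On this set \<open>V x_next \<le> W(x, e) \<le> Vbar\<close>, so trajectories stay in \<open>XV\<close>,
  and geometric decay of a function comparable to the squared distance yields local asymptotic
  stability (\<open>geometric_lyapunov_stability\<close>).

  The bound on the increment uses \<open>\<parallel>zbar x\<parallel> \<le> \<sigma> \<parallel>x\<parallel>\<close>, which is immediate from the Lipschitz property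
  if \<open>0 \<in> XV\<close>. When the origin is only a limit point of \<open>XV\<close>, the Lipschitz extension of
  \<open>zbar\<close> to the closure still solves the optimality system by continuity, and the only solution
  at parameter \<open>0\<close> is \<open>0\<close> (\<open>norm_zbar_le\<close>). When the origin is not even a limit point, no
  initial state is close to it.
\<close>

section \<open>Geometric Lyapunov functions\<close>

lemma geometric_lyapunov_stability:
  fixes \<Phi> :: "'a::metric_space \<Rightarrow> 'a" and W :: "'a \<Rightarrow> real"
  assumes m: "m > 0" and n: "n > 0" and \<rho>: "\<rho> > 0" and q: "0 \<le> q" "q < 1"
    and lower: "\<And>\<xi>. \<xi> \<in> D \<Longrightarrow> m * (dist \<xi> p)\<^sup>2 \<le> W \<xi>"
    and upper: "\<And>\<xi>. \<xi> \<in> D \<Longrightarrow> W \<xi> \<le> n * (dist \<xi> p)\<^sup>2"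
    and step: "\<And>\<xi>. \<xi> \<in> D \<Longrightarrow> W \<xi> \<le> \<rho> \<Longrightarrow> \<Phi> \<xi> \<in> D \<and> W (\<Phi> \<xi>) \<le> q * W \<xi>"
  shows "locally_asymptotically_stable_on D \<Phi> p"
proof -
  have iterate: "(\<Phi> ^^ k) \<xi> \<in> D \<and> W ((\<Phi> ^^ k) \<xi>) \<le> q ^ k * W \<xi>"
    if "\<xi> \<in> D" "W \<xi> \<le> \<rho>" for \<xi> k
  proof (induction k)
    case (Suc k)
    have nonneg: "0 \<le> W \<xi>"
      using lower[OF that(1)] m by (smt (verit) mult_nonneg_nonneg zero_le_power2)
    have "q ^ k * W \<xi> \<le> 1 * W \<xi>"
      using q nonneg by (intro mult_right_mono power_le_one) auto
    then have "W ((\<Phi> ^^ k) \<xi>) \<le> \<rho>" using Suc that by linarith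
    then have *: "\<Phi> ((\<Phi> ^^ k) \<xi>) \<in> D" "W (\<Phi> ((\<Phi> ^^ k) \<xi>)) \<le> q * W ((\<Phi> ^^ k) \<xi>)"
      using step Suc by blast+
    have "q * W ((\<Phi> ^^ k) \<xi>) \<le> q * (q ^ k * W \<xi>)"
      using Suc q by (intro mult_left_mono) auto
    with * show ?case by (simp add: mult.assoc)
  next
    case 0
    show ?case using that by simp
  qed
  have near: "(\<Phi> ^^ k) \<xi> \<in> D \<and> (dist ((\<Phi> ^^ k) \<xi>) p)\<^sup>2 \<le> q ^ k * (n / m) * (dist \<xi> p)\<^sup>2"
    if \<xi>: "\<xi> \<in> D" and d: "dist \<xi> p < sqrt (\<rho> / n)" for \<xi> k
  proof -
    have "(dist \<xi> p)\<^sup>2 < (sqrt (\<rho> / n))\<^sup>2"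
      using d by (intro power_strict_mono) auto
    then have "n * (dist \<xi> p)\<^sup>2 < \<rho>" using n \<rho> by (simp add: field_simps)
    then have "W \<xi> \<le> \<rho>" using upper[OF \<xi>] by linarith
    note it = iterate[OF \<xi> this, of k]
    have "m * (dist ((\<Phi> ^^ k) \<xi>) p)\<^sup>2 \<le> q ^ k * W \<xi>" using it lower by fastforce
    also have "\<dots> \<le> q ^ k * (n * (dist \<xi> p)\<^sup>2)" using upper[OF \<xi>] q by (intro mult_left_mono) auto
    finally show ?thesis using it m by (simp add: field_simps)
  qed
  show ?thesis
    unfolding locally_asymptotically_stable_on_def
  proof (intro conjI allI impI)
    fix \<epsilon> :: real assume \<epsilon>: "\<epsilon> > 0"
    define \<delta> where "\<delta> = min (sqrt (\<rho> / n)) (\<epsilon> * sqrt (m / n))"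
    have "(\<Phi> ^^ k) \<xi> \<in> D \<and> dist ((\<Phi> ^^ k) \<xi>) p < \<epsilon>" if \<xi>: "\<xi> \<in> D" "dist \<xi> p < \<delta>" for \<xi> k
    proof -
      have k: "(\<Phi> ^^ k) \<xi> \<in> D" "(dist ((\<Phi> ^^ k) \<xi>) p)\<^sup>2 \<le> q ^ k * (n / m) * (dist \<xi> p)\<^sup>2"
        using near \<xi> unfolding \<delta>_def by auto
      have "(dist \<xi> p)\<^sup>2 < (\<epsilon> * sqrt (m / n))\<^sup>2"
        using \<xi> unfolding \<delta>_def by (intro power_strict_mono) auto
      then have 1: "(n / m) * (dist \<xi> p)\<^sup>2 < \<epsilon>\<^sup>2"
        using m n by (simp add: field_simps power_mult_distrib)
      have "q ^ k * ((n / m) * (dist \<xi> p)\<^sup>2) \<le> 1 * ((n / m) * (dist \<xi> p)\<^sup>2)"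
        using q m n by (intro mult_right_mono power_le_one) auto
      then have "(dist ((\<Phi> ^^ k) \<xi>) p)\<^sup>2 < \<epsilon>\<^sup>2" using k 1 by (simp add: mult.assoc)
      then show ?thesis using k(1) \<epsilon> power_less_imp_less_base by fastforce
    qed
    moreover have "\<delta> > 0" using \<epsilon> m n \<rho> by (simp add: \<delta>_def)
    ultimately show "\<exists>\<delta>>0. \<forall>\<xi>0\<in>D. dist \<xi>0 p < \<delta> \<longrightarrow>
        (\<forall>k. (\<Phi> ^^ k) \<xi>0 \<in> D \<and> dist ((\<Phi> ^^ k) \<xi>0) p < \<epsilon>)" by blast
  next
    have "(\<lambda>k. (\<Phi> ^^ k) \<xi>) \<longlonglongrightarrow> p" if \<xi>: "\<xi> \<in> D" "dist \<xi> p < sqrt (\<rho> / n)" for \<xi>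
    proof -
      have "(\<lambda>k. q ^ k * ((n / m) * (dist \<xi> p)\<^sup>2)) \<longlonglongrightarrow> 0"
        using q by (intro tendsto_mult_left_zero LIMSEQ_realpow_zero) auto
      then have "(\<lambda>k. (dist ((\<Phi> ^^ k) \<xi>) p)\<^sup>2) \<longlonglongrightarrow> 0"
        by (rule Lim_null_comparison[rotated]) (use near[OF \<xi>] in \<open>simp add: mult.assoc\<close>)
      then have "(\<lambda>k. sqrt ((dist ((\<Phi> ^^ k) \<xi>) p)\<^sup>2)) \<longlonglongrightarrow> sqrt 0"
        by (rule tendsto_real_sqrt)
      then show ?thesis by (simp add: tendsto_dist_iff[of _ p])
    qed
    moreover have "sqrt (\<rho> / n) > 0" using \<rho> n by simp
    ultimately show "\<exists>\<eta>>0. \<forall>\<xi>0\<in>D. dist \<xi>0 p < \<eta> \<longrightarrow> (\<lambda>k. (\<Phi> ^^ k) \<xi>0) \<longlonglongrightarrow> p" by blast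
  qed
qed

section \<open>The solution map near the origin\<close>

lemma C2_bounded_continuous_derivative:
  assumes "C2_bounded h"
  obtains h' where "\<And>y. (h has_derivative blinfun_apply (h' y)) (at y)" "continuous_on UNIV h'"
proof -
  obtain h' h'' where h: "\<And>y. (h has_derivative blinfun_apply (h' y)) (at y)"
      "\<And>y. (h' has_derivative blinfun_apply (h'' y)) (at y)"
    using assms unfolding C2_bounded_def by blast
  then have "continuous_on UNIV h'"
    by (meson has_derivative_at_withinI has_derivative_continuous_on)
  with h(1) that show thesis by blast
qed

lemma continuous_on_FOC_map:
  assumes "C2_bounded f" "C2_bounded g"
  shows "continuous_on UNIV (FOC_map f g)"
proof -
  obtain f' where f': "\<And>y. (f has_derivative blinfun_apply (f' y)) (at y)" "continuous_on UNIV f'"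
    using C2_bounded_continuous_derivative[OF assms(1)] by blast
  obtain g' where g': "\<And>y. (g has_derivative blinfun_apply (g' y)) (at y)" "continuous_on UNIV g'"
    using C2_bounded_continuous_derivative[OF assms(2)] by blast
  have "frechet_derivative f (at y) = blinfun_apply (f' y)"
       "frechet_derivative g (at y) = blinfun_apply (g' y)" for y
    using f'(1) g'(1) frechet_derivative_at by metis+
  then have FOC: "FOC_map f g = (\<lambda>z.
      ((\<chi> i. f' (fst z) (axis i 1)) + (\<chi> i. \<Sum>j\<in>UNIV. (g' (fst z) (axis i 1)) $ j * snd z $ j), g (fst z)))"
    by (auto simp: FOC_map_def gradient_def jacobian_def matrix_def transpose_def
        matrix_vector_mult_def fun_eq_iff)
  have "continuous_on UNIV g"
    using g'(1) by (meson has_derivative_at_withinI has_derivative_continuous_on)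
  note * = continuous_on_compose2[OF f'(2) continuous_on_fst, of UNIV]
    continuous_on_compose2[OF g'(2) continuous_on_fst, of UNIV]
    continuous_on_compose2[OF this continuous_on_fst, of UNIV]
  show ?thesis unfolding FOC
    by (intro continuous_intros *) auto
qed

text \<open>
  The origin may fail to belong to the domain \<open>S\<close>. The Lipschitz extension of \<open>zbar\<close> to the closure
  of \<open>S\<close> inherits the optimality system by continuity, so its value at \<open>0\<close> is forced to be \<open>0\<close>.
\<close>

lemma norm_zbar_le:
  fixes f :: "real ^ 'n \<Rightarrow> real" and g :: "real ^ 'n \<Rightarrow> real ^ 'g" and B :: "real ^ 'x ^ 'g"
  assumes C2: "C2_bounded f" "C2_bounded g"
    and lip: "\<sigma>-lipschitz_on S zbar"
    and sol: "\<And>x. x \<in> S \<Longrightarrow> zbar x \<in> FOC_points f g B x"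
    and zero: "FOC_points f g B 0 = {0}"
    and closure: "0 \<in> closure S" and x: "x \<in> S"
  shows "norm (zbar x) \<le> \<sigma> * norm x"
proof -
  obtain h where h: "\<sigma>-lipschitz_on (closure S) h" "\<forall>x\<in>S. h x = zbar x"
    using lipschitz_extend_closure[OF lip] by blast
  have C_map: "continuous_on (closure S) (C_map B :: _ \<Rightarrow> (real ^ 'n) \<times> _)"
    unfolding C_map_def by (intro continuous_intros)
  have "continuous_on (closure S) (\<lambda>x. FOC_map f g (h x) + C_map B x)"
    by (intro continuous_on_add C_map continuous_on_compose2[OF continuous_on_FOC_map[OF C2]]
        lipschitz_on_continuous_on[OF h(1)]) auto
  moreover have "FOC_map f g (h x) + C_map B x = 0" if "x \<in> S" for x
    using sol[OF that] h(2) that by (simp add: FOC_points_def)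
  ultimately have "FOC_map f g (h 0) + C_map B 0 = 0"
    using continuous_constant_on_closure closure by blast
  then have "h 0 = 0" using zero by (auto simp: FOC_points_def)
  then show ?thesis
    using lipschitz_onD(1)[OF h(1), of x 0] h(2) x closure closure_subset
    by (fastforce simp: dist_norm)
qed

section \<open>Energy decay of the interconnection\<close>

text \<open>
  Convexity of the square, for the weights \<open>\<mu>\<close> and \<open>1 - \<mu>\<close> at the points \<open>a\<close> and \<open>b / (1 - \<mu>)\<close>:
  the factor in front of \<open>a\<^sup>2\<close> stays below one.
\<close>

lemma square_contraction_plus_perturbation:
  fixes a b \<mu> :: real
  assumes "0 \<le> \<mu>" "\<mu> < 1"
  shows "(\<mu> * a + b)\<^sup>2 \<le> \<mu> * a\<^sup>2 + b\<^sup>2 / (1 - \<mu>)"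
proof -
  have "\<mu> * a\<^sup>2 + b\<^sup>2 / (1 - \<mu>) - (\<mu> * a + b)\<^sup>2 = \<mu> * (1 - \<mu>) * (a - b / (1 - \<mu>))\<^sup>2"
    using assms by (simp add: divide_simps) algebra
  also have "\<dots> \<ge> 0" using assms by simp
  finally show ?thesis by linarith
qed

text \<open>
  Here \<open>x\<close> and \<open>e\<close> stand for the norms of state and optimizer error, \<open>v\<close> for the value function, and
  primes for the next step. The two smallness conditions on \<open>T\<close> let half of each dissipation
  term absorb the opposite cross term.
\<close>

lemma composite_energy_decay:
  fixes v v' x e e' T :: real
  assumes T: "0 \<le> T" "T * (b\<^sup>2 / (1 - \<mu>)) \<le> a3 / 2" "T * c \<le> (1 - \<mu>) / 2"
    and \<mu>: "0 \<le> \<mu>" "\<mu> < 1" and a2: "a2 > 0"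
    and v: "v \<le> a2 * x\<^sup>2" "0 \<le> v"
    and value_step: "v' \<le> v - T * a3 * x\<^sup>2 + T * c * e\<^sup>2"
    and error_step: "0 \<le> e'" "e' \<le> \<mu> * e + T * b * x"
  shows "v' + e'\<^sup>2 \<le> (1 - min (T * a3 / (2 * a2)) ((1 - \<mu>) / 2)) * (v + e\<^sup>2)"
proof -
  let ?q = "min (T * a3 / (2 * a2)) ((1 - \<mu>) / 2)"
  have "e'\<^sup>2 \<le> (\<mu> * e + T * b * x)\<^sup>2" using error_step by (intro power_mono) auto
  also have "\<dots> \<le> \<mu> * e\<^sup>2 + (T * b * x)\<^sup>2 / (1 - \<mu>)"
    using \<mu> by (rule square_contraction_plus_perturbation)
  also have "(T * b * x)\<^sup>2 / (1 - \<mu>) = (T * (b\<^sup>2 / (1 - \<mu>))) * (T * x\<^sup>2)"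
    by (simp add: power2_eq_square)
  also have "\<dots> \<le> (a3 / 2) * (T * x\<^sup>2)"
    using T by (intro mult_right_mono) auto
  finally have e': "e'\<^sup>2 \<le> \<mu> * e\<^sup>2 + T * a3 / 2 * x\<^sup>2" by (simp add: ac_simps)
  have "?q * v \<le> T * a3 / (2 * a2) * v" using v by (intro mult_right_mono) auto
  also have "\<dots> \<le> T * a3 / (2 * a2) * (a2 * x\<^sup>2)"
  proof (intro mult_left_mono v(1))
    have "0 \<le> b\<^sup>2 / (1 - \<mu>)" using \<mu> by simp
    then have "0 \<le> a3" using T mult_nonneg_nonneg by (smt (verit) field_sum_of_halves)
    then show "0 \<le> T * a3 / (2 * a2)" using T a2 by simp
  qed
  also have "\<dots> = T * a3 / 2 * x\<^sup>2" using a2 by simp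
  finally have qv: "?q * v \<le> T * a3 / 2 * x\<^sup>2" .
  have qe: "?q * e\<^sup>2 \<le> (1 - \<mu>) / 2 * e\<^sup>2" by (intro mult_right_mono min.cobounded2) simp
  have ce: "T * c * e\<^sup>2 \<le> (1 - \<mu>) / 2 * e\<^sup>2" using T by (intro mult_right_mono) auto
  have "v' + e'\<^sup>2 \<le> v + e\<^sup>2 - T * a3 / 2 * x\<^sup>2 - (1 - \<mu>) / 2 * e\<^sup>2"
    using value_step e' ce by (simp add: algebra_simps) (simp add: field_simps)
  also have "\<dots> \<le> v + e\<^sup>2 - ?q * v - ?q * e\<^sup>2" using qv qe by linarith
  finally show ?thesis by (simp add: algebra_simps)
qed

lemma norm_M_uz_le:
  assumes "onorm ((*v) M) = 1"
  shows "norm (M_uz M z) \<le> norm z"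
proof -
  have "norm (M_uz M z) \<le> onorm ((*v) M) * norm (fst z)"
    unfolding M_uz_def by (intro onorm matrix_vector_mul_bounded_linear)
  then show ?thesis using assms norm_fst_le[of "fst z" "snd z"] by simp
qed

section \<open>Local asymptotic stability for small sampling times\<close>

theorem corollary24:
  fixes f :: "real ^ 'n \<Rightarrow> real"
    and g :: "real ^ 'n \<Rightarrow> real ^ 'g"
    and B :: "real ^ 'x ^ 'g"
    and ybar :: "real ^ 'x \<Rightarrow> real ^ 'n"
    and zbar :: "real ^ 'x \<Rightarrow> (real ^ 'n) \<times> (real ^ 'g)"
    and X XV :: "(real ^ 'x) set"
    and V :: "real ^ 'x \<Rightarrow> real"
    and M :: "real ^ 'n ^ 'u"
    and \<phi> :: "real ^ 'x \<Rightarrow> real ^ 'u \<Rightarrow> real ^ 'x"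
    and \<psi> :: "real \<Rightarrow> real ^ 'x \<Rightarrow> real ^ 'u \<Rightarrow> real ^ 'x"
    and opt :: "real ^ 'x \<Rightarrow> (real ^ 'n) \<times> (real ^ 'g) \<Rightarrow> (real ^ 'n) \<times> (real ^ 'g)"
    and Vbar a1 a2 a3 T0 rhat_z \<kappa> L_x L_u r_z r_x \<sigma> :: real
  assumes X: "X = {x. \<exists>y. solves_P f g B x y}"
    and ybar: "\<forall>x\<in>X. solves_P f g B x (ybar x)"
    and V: "V = (\<lambda>x. f (ybar x))"
    and Vbar: "Vbar > 0"
    and XV: "XV = {x \<in> X. V x \<le> Vbar}"
    and M: "selection_matrix M" "onorm ((*v) M) = 1"
    and equilibrium: "\<phi> 0 0 = 0"
    and positive: "a1 > 0" "a2 > 0" "a3 > 0" "T0 > 0"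
    and flow: "\<forall>x\<in>XV. \<forall>u. \<forall>T\<in>{0<..T0}.
        ode_solution \<phi> u x T (\<lambda>t. \<psi> t x u) \<and>
        (\<forall>s. ode_solution \<phi> u x T s \<longrightarrow> (\<forall>t\<in>{0..T}. s t = \<psi> t x u))"
    and smoothness: "C2_bounded f" "C2_bounded g"
    and lyapunov: "\<forall>x\<in>XV. \<forall>T\<in>{0<..T0}.
        a1 * (norm x)\<^sup>2 \<le> V x \<and> V x \<le> a2 * (norm x)\<^sup>2 \<and>
        \<psi> T x (M *v ybar x) \<in> X \<and>
        V (\<psi> T x (M *v ybar x)) - V x \<le> - T * a3 * (norm x)\<^sup>2"
    and growth: "\<exists>R c \<delta>. c > 0 \<and> \<delta> > 0 \<and>
        (\<forall>u. \<forall>x\<in>XV. \<forall>T\<in>{0<..T0}.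
           \<psi> T x u \<in> X \<and>
           V (\<psi> T x u) - V x \<le> - T * a3 * (norm x)\<^sup>2 + T * R T x u \<and>
           (norm (u - M *v ybar x) \<le> \<delta> \<longrightarrow> \<bar>R T x u\<bar> \<le> c * (norm (u - M *v ybar x))\<^sup>2))"
    and regularity: "\<forall>x\<in>XV. FOC_points f g B x = {zbar x} \<and> fst (zbar x) = ybar x \<and>
        SOSC f g B x (zbar x)"
    and regularity_0: "FOC_points f g B 0 = {0}" "zbar 0 = 0"
    and contraction: "rhat_z > 0" "0 < \<kappa>" "\<kappa> < 1"
        "\<forall>x\<in>XV. \<forall>z\<in>cball (zbar x) rhat_z. norm (opt x z - zbar x) \<le> \<kappa> * norm (z - zbar x)"
    and state_evolution: "L_x > 0" "L_u > 0"
        "\<forall>x\<in>XV. \<forall>z. \<forall>T\<in>{0<..T0}. norm (z - zbar x) \<le> r_z \<longrightarrow>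
           norm (\<psi> T x (M_uz M z) - x) \<le> T * (L_x * norm x + L_u * norm (M_uz M z))"
    and constants: "r_z > 0" "r_x > 0" "\<sigma> > 0" "\<sigma>-lipschitz_on XV zbar"
        "\<forall>x\<in>XV. \<forall>z\<in>cball (zbar x) r_z. \<forall>x_next\<in>cball x r_x \<inter> XV.
           norm (opt x_next z - zbar x_next) \<le> \<kappa> * norm (z - zbar x) + \<sigma> * \<kappa> * norm (x_next - x)"
  shows "\<exists>Tstar>0. \<forall>T\<in>{0<..Tstar}.
    locally_asymptotically_stable_on (XV \<times> UNIV) (error_map \<psi> opt M zbar T) 0"
proof (cases "0 \<in> closure XV")
  case False
  then obtain d where d: "d > 0" "\<And>x. x \<in> XV \<Longrightarrow> \<not> dist x 0 < d"
    by (auto simp: closure_approachable)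
  \<comment> \<open>No point of the domain is close to the origin.\<close>
  have "\<not> dist \<xi> 0 < d" if "\<xi> \<in> XV \<times> UNIV" for \<xi> :: "(real ^ 'x) \<times> (real ^ 'n) \<times> (real ^ 'g)"
    using d(2)[of "fst \<xi>"] that norm_fst_le[of "fst \<xi>" "snd \<xi>"] by auto
  then have "locally_asymptotically_stable_on (XV \<times> UNIV) (error_map \<psi> opt M zbar T) 0" for T
    unfolding locally_asymptotically_stable_on_def using d(1) by blast
  then show ?thesis using zero_less_one by blast
next
  case True
  obtain R c \<delta> where c: "c > 0" and \<delta>: "\<delta> > 0"
    and R: "\<And>u x T. x \<in> XV \<Longrightarrow> T \<in> {0<..T0} \<Longrightarrow> \<psi> T x u \<in> X \<and>
           V (\<psi> T x u) - V x \<le> - T * a3 * (norm x)\<^sup>2 + T * R T x u \<and>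
           (norm (u - M *v ybar x) \<le> \<delta> \<longrightarrow> \<bar>R T x u\<bar> \<le> c * (norm (u - M *v ybar x))\<^sup>2)"
    using growth by metis
  have value_bounds: "a1 * (norm x)\<^sup>2 \<le> V x" "V x \<le> a2 * (norm x)\<^sup>2" if "x \<in> XV" for x
    using lyapunov positive that by (auto dest!: bspec[of _ _ T0] bspec[of _ _ x])
  have zbar_le: "norm (zbar x) \<le> \<sigma> * norm x" if "x \<in> XV" for x
    using norm_zbar_le[OF smoothness constants(4) _ regularity_0(1) True that] regularity by blast
  define K where "K = L_x + L_u * \<sigma>"
  have K: "K > 0" using state_evolution constants by (simp add: K_def add_pos_pos)
  define b where "b = \<sigma> * \<kappa> * K"
  have b: "b > 0" using constants contraction K by (simp add: b_def)
  define \<mu> where "\<mu> = (1 + \<kappa>) / 2"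
  have \<mu>: "0 < \<mu>" "\<mu> < 1" using contraction by (auto simp: \<mu>_def)
  \<comment> \<open>Every hypothesis that holds only locally applies to errors and states of norm at most \<open>r\<close>.\<close>
  define r where "r = Min {r_z, \<delta>, r_x / (K + L_u)}"
  have r: "r > 0" "r \<le> r_z" "r \<le> \<delta>" "r \<le> r_x / (K + L_u)"
    using constants \<delta> K state_evolution by (auto simp: r_def)
  \<comment> \<open>The third bound keeps the perturbed contraction factor \<open>\<kappa> + T \<sigma> \<kappa> L_u\<close> below \<open>\<mu>\<close>; the last two
    are the smallness conditions of the energy estimate.\<close>
  define Tstar where "Tstar = Min {T0, 1, (1 - \<kappa>) / (2 * (\<sigma> * \<kappa> * L_u)),
      (a3 / 2) / (b\<^sup>2 / (1 - \<mu>)), ((1 - \<mu>) / 2) / c}"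
  have Tstar: "Tstar > 0"
    using positive contraction constants state_evolution b c \<mu> by (auto simp: Tstar_def)
  define W where "W = (\<lambda>\<xi> :: (real ^ 'x) \<times> (real ^ 'n) \<times> (real ^ 'g).
      V (fst \<xi>) + (norm (snd \<xi>))\<^sup>2)"
  define m where "m = min a1 1"
  have m: "m > 0" using positive by (simp add: m_def)
  have norm_\<xi>: "(norm \<xi>)\<^sup>2 = (norm (fst \<xi>))\<^sup>2 + (norm (snd \<xi>))\<^sup>2"
    for \<xi> :: "(real ^ 'x) \<times> (real ^ 'n) \<times> (real ^ 'g)"
    by (simp add: norm_prod_def)
  have W_lower: "m * (dist \<xi> 0)\<^sup>2 \<le> W \<xi>" if "\<xi> \<in> XV \<times> UNIV" for \<xi>
  proof -
    have "m * (norm (fst \<xi>))\<^sup>2 \<le> a1 * (norm (fst \<xi>))\<^sup>2" "m * (norm (snd \<xi>))\<^sup>2 \<le> 1 * (norm (snd \<xi>))\<^sup>2"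
      by (intro mult_right_mono; simp add: m_def)+
    moreover have "fst \<xi> \<in> XV" using that by auto
    ultimately show ?thesis
      using value_bounds(1)[of "fst \<xi>"] by (simp add: W_def norm_\<xi> distrib_left)
  qed
  have W_upper: "W \<xi> \<le> max a2 1 * (dist \<xi> 0)\<^sup>2" if "\<xi> \<in> XV \<times> UNIV" for \<xi>
  proof -
    have "a2 * (norm (fst \<xi>))\<^sup>2 \<le> max a2 1 * (norm (fst \<xi>))\<^sup>2"
         "1 * (norm (snd \<xi>))\<^sup>2 \<le> max a2 1 * (norm (snd \<xi>))\<^sup>2"
      by (intro mult_right_mono; simp)+
    moreover have "fst \<xi> \<in> XV" using that by auto
    ultimately show ?thesis
      using value_bounds(2)[of "fst \<xi>"] by (simp add: W_def norm_\<xi> distrib_left)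
  qed
  have "locally_asymptotically_stable_on (XV \<times> UNIV) (error_map \<psi> opt M zbar T) 0"
    if "T \<in> {0<..Tstar}" for T
  proof -
    have T: "0 < T" "T \<le> 1" "T \<in> {0<..T0}"
      and T3: "T \<le> (1 - \<kappa>) / (2 * (\<sigma> * \<kappa> * L_u))"
      and T4: "T \<le> (a3 / 2) / (b\<^sup>2 / (1 - \<mu>))" and T5: "T \<le> ((1 - \<mu>) / 2) / c"
      using that by (auto simp: Tstar_def)
    have T_contract: "\<kappa> + T * (\<sigma> * \<kappa> * L_u) \<le> \<mu>"
    proof -
      have "\<sigma> * \<kappa> * L_u > 0" using constants contraction state_evolution by simp
      then have "T * (\<sigma> * \<kappa> * L_u) \<le> (1 - \<kappa>) / 2" using T3 by (simp add: field_simps)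
      then show ?thesis by (simp add: \<mu>_def field_simps)
    qed
    have "b\<^sup>2 / (1 - \<mu>) > 0" using b \<mu> by simp
    then have T_b: "T * (b\<^sup>2 / (1 - \<mu>)) \<le> a3 / 2"
      using T4 pos_le_divide_eq by blast
    have T_c: "T * c \<le> (1 - \<mu>) / 2" using T5 c pos_le_divide_eq by blast
    define q where "q = min (T * a3 / (2 * a2)) ((1 - \<mu>) / 2)"
    have q: "0 < q" "q \<le> 1" using T positive \<mu> by (auto simp: q_def min_le_iff_disj)
    have "error_map \<psi> opt M zbar T \<xi> \<in> XV \<times> UNIV \<and>
        W (error_map \<psi> opt M zbar T \<xi>) \<le> (1 - q) * W \<xi>"
      if \<xi>: "\<xi> \<in> XV \<times> UNIV" and small: "W \<xi> \<le> min Vbar (m * r\<^sup>2)" for \<xi>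
    proof -
      obtain x e where xe: "\<xi> = (x, e)" by (cases \<xi>)
      have x: "x \<in> XV" using \<xi> xe by auto
      define z where "z = e + zbar x"
      define x_next where "x_next = \<psi> T x (M_uz M z)"
      define e_next where "e_next = opt x_next z - zbar x_next"
      have map: "error_map \<psi> opt M zbar T \<xi> = (x_next, e_next)"
        by (simp add: error_map_def xe Let_def z_def x_next_def e_next_def)
      have "m * (norm \<xi>)\<^sup>2 \<le> m * r\<^sup>2" using W_lower[OF \<xi>] small by simp
      then have "norm \<xi> \<le> r" using m r power2_le_imp_le[of "norm \<xi>" r] by simp
      then have xr: "norm x \<le> r" and er: "norm e \<le> r"
        using norm_fst_le[of x e] norm_snd_le[of e x] xe by auto
      have input_error: "norm (M_uz M z - M *v ybar x) \<le> norm e"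
      proof -
        have "M_uz M z - M *v ybar x = M_uz M e"
          using regularity x by (simp add: M_uz_def z_def matrix_vector_right_distrib)
        then show ?thesis using norm_M_uz_le[OF M(2)] by simp
      qed
      have "\<bar>R T x (M_uz M z)\<bar> \<le> c * (norm (M_uz M z - M *v ybar x))\<^sup>2"
        using R[OF x T(3)] input_error er r by force
      also have "\<dots> \<le> c * (norm e)\<^sup>2"
        using input_error c by (intro mult_left_mono power_mono) auto
      finally have "T * R T x (M_uz M z) \<le> T * (c * (norm e)\<^sup>2)"
        using T by (intro mult_left_mono) auto
      then have value_step: "V x_next \<le> V x - T * a3 * (norm x)\<^sup>2 + T * c * (norm e)\<^sup>2"
        using R[OF x T(3), of "M_uz M z"] by (simp add: x_next_def)
      \<comment> \<open>As \<open>T * c \<le> 1\<close>, the possible increase of the value is paid for by the error part of \<open>W\<close>.\<close>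
      have x_next: "x_next \<in> XV"
      proof -
        have "T * c * (norm e)\<^sup>2 \<le> 1 * (norm e)\<^sup>2" using T_c \<mu> by (intro mult_right_mono) auto
        moreover have "0 \<le> T * a3 * (norm x)\<^sup>2" using T positive by simp
        ultimately have "V x_next \<le> W \<xi>" using value_step by (simp add: W_def xe)
        then show ?thesis using small R[OF x T(3)] by (auto simp: XV x_next_def)
      qed
      have z: "norm (z - zbar x) \<le> r_z" using er r by (simp add: z_def)
      have increment: "norm (x_next - x) \<le> T * (K * norm x + L_u * norm e)"
      proof -
        have "norm (M_uz M z) \<le> norm e + \<sigma> * norm x"
          using norm_M_uz_le[OF M(2), of z] norm_triangle_ineq[of e "zbar x"] zbar_le[OF x]
          by (simp add: z_def)
        then have "L_u * norm (M_uz M z) \<le> L_u * (norm e + \<sigma> * norm x)"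
          using state_evolution(2) by (intro mult_left_mono) auto
        then have "L_x * norm x + L_u * norm (M_uz M z) \<le> K * norm x + L_u * norm e"
          by (simp add: K_def algebra_simps)
        then have "T * (L_x * norm x + L_u * norm (M_uz M z)) \<le> T * (K * norm x + L_u * norm e)"
          using T by (intro mult_left_mono) auto
        moreover have "norm (x_next - x) \<le> T * (L_x * norm x + L_u * norm (M_uz M z))"
          unfolding x_next_def using state_evolution(3) x T(3) z by blast
        ultimately show ?thesis by linarith
      qed
      have "norm (x_next - x) \<le> r_x"
      proof -
        have "K * norm x + L_u * norm e \<le> K * r + L_u * r"
          using K state_evolution xr er by (intro add_mono mult_left_mono) auto
        also have "\<dots> = (K + L_u) * r" by (simp add: algebra_simps)
        also have "\<dots> \<le> r_x" using r(4) K state_evolution by (simp add: field_simps)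
        finally have "T * (K * norm x + L_u * norm e) \<le> 1 * r_x"
          using T K state_evolution constants by (intro mult_mono) auto
        then show ?thesis using increment by simp
      qed
      then have "norm e_next \<le> \<kappa> * norm e + \<sigma> * \<kappa> * norm (x_next - x)"
        using constants(5)[rule_format, of x z x_next] x x_next z
        by (simp add: e_next_def z_def dist_norm norm_minus_commute)
      also have "\<dots> \<le> \<kappa> * norm e + \<sigma> * \<kappa> * (T * (K * norm x + L_u * norm e))"
        using increment constants contraction by (intro add_left_mono mult_left_mono) auto
      also have "\<dots> = (\<kappa> + T * (\<sigma> * \<kappa> * L_u)) * norm e + T * b * norm x"
        by (simp add: b_def algebra_simps)
      also have "\<dots> \<le> \<mu> * norm e + T * b * norm x"
        using T_contract by (intro add_right_mono mult_right_mono) auto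
      finally have error_step: "norm e_next \<le> \<mu> * norm e + T * b * norm x" .
      have "0 \<le> V x" using value_bounds(1)[OF x] positive
        by (smt (verit) mult_nonneg_nonneg zero_le_power2)
      then have "V x_next + (norm e_next)\<^sup>2 \<le> (1 - q) * (V x + (norm e)\<^sup>2)"
        unfolding q_def using T(1) \<mu> positive
        by (intro composite_energy_decay[OF _ T_b T_c _ _ _ value_bounds(2)[OF x] _
              value_step _ error_step]) auto
      then show ?thesis using x_next by (simp add: map[unfolded xe] W_def xe)
    qed
    then show ?thesis
      using m r(1) Vbar q
      by (intro geometric_lyapunov_stability[of m "max a2 1" "min Vbar (m * r\<^sup>2)" "1 - q"
            "XV \<times> UNIV" 0 W, OF _ _ _ _ _ W_lower W_upper]) auto
  qed
  then show ?thesis using Tstar by blast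
qed

end
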